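(* Let the problem data $f^{(1)},f^{(2)},g^{(1)},g^{(2)}$ satisfy the Basic Assumption (see context), and suppose in addition that $\nabla f^{(i)}$ is globally $L_{f^{(i)}}$-Lipschitz continuous on $\mathbb R^n$, $i=1,2$. Let $(x_k)_{k\in\mathbb N}$ be generated by the algorithm staBiM (see context), where the sequence $(\sigma_k)_{k\in\mathbb N}$ satisfies $\sigma_k\searrow0$ and $\sum_{k\in\mathbb N}\sigma_k=\infty$. Then ($(x_k)_{k\in\mathbb N}$ is bounded and) $(\operatorname{dist}(x_k,\mathcal X_\star))_{k\in\mathbb N}$ converges to zero. Moreover, the following sublinear rates hold: $$\min_{k\le K}\|x_{k+1}-x_k\|^2\le\frac{\nu\,\bar\varphi_0(x_0)}{(1-\nu)L_{f^{(2)}}(1+K)}$$ and $$\min_{k\le K}\operatorname{dist}^2\bigl(0,\partial\varphi_k(x_{k+1})\bigr)\le\Bigl(1+\sigma_0\frac{L_{f^{(1)}}}{L_{f^{(2)}}}\Bigr)\frac{M_{\max}^2\,\bar\varphi_0(x_0)}{(1-\nu)(1+K)},$$ where $M_{\max}=1+\nu+\nu\sigma_0L_{f^{(1)}}/L_{f^{(2)}}$ and $\bar\varphi_0:=\sigma_0(\varphi^{(1)}-\bar\phi^{(1)})+\varphi^{(2)}-\bar\phi^{(2)}$.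
   Context: Bilevel problem: minimize $\varphi^{(1)}(x)=f^{(1)}(x)+g^{(1)}(x)$ over $x\in\mathcal X^{(2)}=\operatorname{argmin}_{w\in\mathbb R^n}\varphi^{(2)}(w)$, where $\varphi^{(2)}=f^{(2)}+g^{(2)}$. Basic Assumption: (1) $f^{(1)},f^{(2)}:\mathbb R^n\to\mathbb R$ are convex and have locally Lipschitz-continuous gradients; (2) $g^{(1)},g^{(2)}:\mathbb R^n\to\mathbb R\cup\{\infty\}$ are proper, lower semicontinuous and convex, with easy to compute proximal mappings; (3) $\bar\phi^{(1)}:=\inf_{x\in\operatorname{dom}\varphi^{(2)}}\varphi^{(1)}(x)>-\infty$; (4) the solution set $\mathcal X_\star:=\operatorname{argmin}\{\varphi^{(1)}(x): x\in\mathcal X^{(2)}\}$ is nonempty and bounded; in particular $\bar\phi^{(2)}:=\inf_{\mathbb R^n}\varphi^{(2)}>-\infty$. Notation: $f_k=\sigma_kf^{(1)}+f^{(2)}$, $g_k=\sigma_kg^{(1)}+g^{(2)}$, $\varphi_k=f_k+g_k=\sigma_k\varphi^{(1)}+\varphi^{(2)}$; $\operatorname{dom}h=\{x: h(x)<\infty\}$, $\operatorname{prox}_h(x)=\operatorname{argmin}_w\{h(w)+\tfrac12\|w-x\|^2\}$, $\partial$ is the convex subdifferential, $\operatorname{dist}(x,E)=\inf_{z\in E}\|z-x\|$, $\|\cdot\|$ is the Euclidean norm, and $0\in\mathbb N$. Algorithm staBiM. Inputs: $x_0\in\mathbb R^n$, $\sigma_0>0$, $\nu\in(0,1)$. For $k=0,1,\dots$: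 choose $\sigma_{k+1}\in[\tfrac34\sigma_k,\sigma_k]$, set $\alpha_{k+1}=\dfrac{\nu}{\sigma_{k+1}L_{f^{(1)}}+L_{f^{(2)}}}$ and $x_{k+1}=\operatorname{prox}_{\alpha_{k+1}g_{k+1}}\bigl(x_k-\alpha_{k+1}\nabla f_{k+1}(x_k)\bigr)$.
   Formalization: The second rate is false as printed; it is proved with ∂φ_{k+1}(x_{k+1}) in place of ∂φ_k(x_{k+1}) and with an extra factor L_{f^(2)}/ν on the right-hand side. L_{f^(1)}+L_{f^(2)}>0 is assumed throughout, and L_{f^(2)}>0 for the rates. *)

theory Defs
  imports "HOL-Analysis.Analysis"
begin

section \<open>Extended-valued convex functions\<close>

definition effdom :: "('a \<Rightarrow> ereal) \<Rightarrow> 'a set" where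
  "effdom h = {x. h x < \<infinity>}"

definition proper_fun :: "('a \<Rightarrow> ereal) \<Rightarrow> bool" where
  "proper_fun h \<longleftrightarrow> effdom h \<noteq> {} \<and> (\<forall>x. h x \<noteq> -\<infinity>)"

definition lsc_fun :: "('a::topological_space \<Rightarrow> ereal) \<Rightarrow> bool" where
  "lsc_fun h \<longleftrightarrow> (\<forall>x. h x \<le> Liminf (at x) h)"

text \<open>Only used together with properness, so no sum of opposite infinities occurs.\<close>

definition convex_fun :: "('a::real_vector \<Rightarrow> ereal) \<Rightarrow> bool" where
  "convex_fun h \<longleftrightarrow> (\<forall>x y t. 0 < t \<and> t < 1 \<longrightarrow>
     h ((1 - t) *\<^sub>R x + t *\<^sub>R y) \<le> ereal (1 - t) * h x + ereal t * h y)"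

text \<open>
  The usual convention of variational analysis: a function that is identically infinite on
  the feasible set has no minimizers there.
\<close>

definition argmin_on :: "('a \<Rightarrow> ereal) \<Rightarrow> 'a set \<Rightarrow> 'a set" where
  "argmin_on h S = {x. h x < \<infinity> \<and> is_arg_min h (\<lambda>w. w \<in> S) x}"

definition prox :: "('a::real_normed_vector \<Rightarrow> ereal) \<Rightarrow> 'a \<Rightarrow> 'a set" where
  "prox h x = argmin_on (\<lambda>w. h w + ereal (1 / 2 * (norm (w - x))\<^sup>2)) UNIV"

definition subdiff :: "('a::real_inner \<Rightarrow> ereal) \<Rightarrow> 'a \<Rightarrow> 'a set" where
  "subdiff h x = {v. \<forall>y. h y \<ge> h x + ereal (v \<bullet> (y - x))}"

text \<open>
  A subdifferential may be empty, and its distance to a point is then \<open>\<infinity>\<close>; the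
  library's \<open>infdist\<close> is \<open>0\<close> in that case.
\<close>

definition edist_set :: "'a::real_normed_vector \<Rightarrow> 'a set \<Rightarrow> ereal" where
  "edist_set x E = (INF z\<in>E. ereal (norm (z - x)))"

section \<open>Smooth functions\<close>

definition grad :: "('a::real_inner \<Rightarrow> real) \<Rightarrow> 'a \<Rightarrow> 'a" where
  "grad f x = (THE D. GDERIV f x :> D)"

definition locally_lipschitz :: "('a::metric_space \<Rightarrow> 'b::metric_space) \<Rightarrow> bool" where
  "locally_lipschitz F \<longleftrightarrow> (\<forall>x. \<exists>u>0. \<exists>L. L-lipschitz_on (cball x u) F)"

definition smooth_convex :: "('a::real_inner \<Rightarrow> real) \<Rightarrow> bool" where
  "smooth_convex f \<longleftrightarrow>
     convex_on UNIV f \<and> (\<forall>x. \<exists>D. GDERIV f x :> D) \<and> locally_lipschitz (grad f)"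

section \<open>The simple bilevel problem\<close>

definition objective :: "('a \<Rightarrow> real) \<Rightarrow> ('a \<Rightarrow> ereal) \<Rightarrow> 'a \<Rightarrow> ereal" where
  "objective f g x = ereal (f x) + g x"

definition wsum :: "real \<Rightarrow> ('a \<Rightarrow> ereal) \<Rightarrow> ('a \<Rightarrow> ereal) \<Rightarrow> 'a \<Rightarrow> ereal" where
  "wsum s h1 h2 x = ereal s * h1 x + h2 x"

definition upper_inf :: "('a \<Rightarrow> ereal) \<Rightarrow> ('a \<Rightarrow> ereal) \<Rightarrow> ereal" where
  "upper_inf \<phi>1 \<phi>2 = (INF x\<in>effdom \<phi>2. \<phi>1 x)"

definition lower_inf :: "('a \<Rightarrow> ereal) \<Rightarrow> ereal" where
  "lower_inf \<phi>2 = (INF x. \<phi>2 x)"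

definition bilevel_solutions :: "('a \<Rightarrow> ereal) \<Rightarrow> ('a \<Rightarrow> ereal) \<Rightarrow> 'a set" where
  "bilevel_solutions \<phi>1 \<phi>2 = argmin_on \<phi>1 (argmin_on \<phi>2 UNIV)"

definition basic_assumption ::
  "('a::real_inner \<Rightarrow> real) \<Rightarrow> ('a \<Rightarrow> real) \<Rightarrow> ('a \<Rightarrow> ereal) \<Rightarrow> ('a \<Rightarrow> ereal) \<Rightarrow> bool" where
  "basic_assumption f1 f2 g1 g2 \<longleftrightarrow>
     smooth_convex f1 \<and> smooth_convex f2 \<and>
     proper_fun g1 \<and> lsc_fun g1 \<and> convex_fun g1 \<and>
     proper_fun g2 \<and> lsc_fun g2 \<and> convex_fun g2 \<and>
     upper_inf (objective f1 g1) (objective f2 g2) > -\<infinity> \<and>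
     bilevel_solutions (objective f1 g1) (objective f2 g2) \<noteq> {} \<and>
     bounded (bilevel_solutions (objective f1 g1) (objective f2 g2))"

definition shifted_objective ::
  "real \<Rightarrow> ('a \<Rightarrow> ereal) \<Rightarrow> ('a \<Rightarrow> ereal) \<Rightarrow> 'a \<Rightarrow> ereal" where
  "shifted_objective s \<phi>1 \<phi>2 x =
     ereal s * (\<phi>1 x - upper_inf \<phi>1 \<phi>2) + \<phi>2 x - lower_inf \<phi>2"

section \<open>The algorithm staBiM\<close>

definition stabim_step :: "real \<Rightarrow> real \<Rightarrow> real \<Rightarrow> real \<Rightarrow> real" where
  "stabim_step L1 L2 \<nu> s = \<nu> / (s * L1 + L2)"

definition staBiM ::
  "('a::real_inner \<Rightarrow> real) \<Rightarrow> ('a \<Rightarrow> real) \<Rightarrow> ('a \<Rightarrow> ereal) \<Rightarrow> ('a \<Rightarrow> ereal) \<Rightarrow>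
   real \<Rightarrow> real \<Rightarrow> real \<Rightarrow> (nat \<Rightarrow> real) \<Rightarrow> (nat \<Rightarrow> 'a) \<Rightarrow> bool" where
  "staBiM f1 f2 g1 g2 L1 L2 \<nu> \<sigma> x \<longleftrightarrow>
     0 < \<sigma> 0 \<and> 0 < \<nu> \<and> \<nu> < 1 \<and>
     (\<forall>k. \<sigma> (Suc k) \<in> {3 / 4 * \<sigma> k..\<sigma> k} \<and>
       (let \<alpha> = stabim_step L1 L2 \<nu> (\<sigma> (Suc k));
            fk = (\<lambda>w. \<sigma> (Suc k) * f1 w + f2 w);
            gk = wsum (\<sigma> (Suc k)) g1 g2
        in x (Suc k) \<in> prox (\<lambda>w. ereal \<alpha> * gk w) (x k - \<alpha> *\<^sub>R grad fk (x k))))"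

end

theory Submission
  imports Defs
begin

text \<open>
  Write \<open>p\<close> and \<open>q\<close> for the optimal values of the two levels, \<open>u\<close> for the infimum of the upper
  objective over the domain of the lower one, and \<open>S\<close> for the solution set. Everything rests on
  the inequality for one proximal gradient step (\<open>step_inequality\<close>): for every \<open>y\<close>, the value
  of the penalised objective \<open>\<sigma> \<phi>1 + \<phi>2\<close> at the new iterate exceeds its value at \<open>y\<close> by at most
  the decrease of \<open>\<parallel>x - y\<parallel>\<^sup>2 / (2 \<alpha>)\<close>, less a multiple of the squared length of the step.

  Convergence. Take \<open>y\<close> in \<open>S\<close>. The penalised gap at the new iterate,
  \<open>\<delta> = \<sigma> (\<phi>1 - p) + (\<phi>2 - q)\<close>, does not depend on the choice of \<open>y\<close>. It can be negative,
  since the iterates may leave the lower solution set, so the distances to \<open>S\<close> need not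
  decrease. But for each \<open>\<eta> > 0\<close> one of two cases occurs. If \<open>\<delta> > \<eta> \<sigma>\<close>, then \<open>\<delta> > 0\<close> and the
  step brings the iterate no farther from any point of \<open>S\<close>. If \<open>\<delta> \<le> \<eta> \<sigma>\<close>, then \<open>\<phi>1 \<le> p + \<eta>\<close>
  because \<open>\<phi>2 \<ge> q\<close>, and \<open>\<phi>2 \<le> q + \<sigma> (\<eta> + p - u)\<close> because \<open>\<phi>1 \<ge> u\<close>; so both objectives are almost
  optimal once \<open>\<sigma>\<close> is small. As \<open>S\<close> is a nonempty bounded joint sublevel set of convex lower
  semicontinuous functions, almost optimal points lie close to it (\<open>sublevel_set_stable\<close>).
  The second case recurs for ever, because otherwise the distances to a point of \<open>S\<close> would
  bound \<open>\<Sum>\<sigma>\<close>. Hence the iterates come close to \<open>S\<close> at some time, and stay close from then on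
  (\<open>penalised_fejer_convergence\<close>).

  Rates. Take for \<open>y\<close> the current iterate. As \<open>\<phi>1 \<ge> u\<close> on the domain of \<open>\<phi>2\<close> and \<open>\<sigma>\<close> does not
  increase, the nonnegative quantity \<open>\<sigma> (\<phi>1 - u) + (\<phi>2 - q)\<close> decreases along the iteration by
  at least \<open>(1 - \<nu>) / \<alpha>\<close> times the squared length of the step (\<open>descent\<close>). Telescoping
  produces an index at which this multiple is at most a \<open>1 / (1 + K)\<close> fraction of the initial
  value, and at this single index both claimed bounds hold (\<open>rates\<close>), since the optimality
  conditions of the step exhibit a subgradient of norm at most \<open>(1 + \<nu>) / \<alpha>\<close> times the length
  of the step.
\<close>

section \<open>Smooth convex functions\<close>

lemma grad_eqI:
  assumes "GDERIV f x :> D"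
  shows "grad f x = D"
  unfolding grad_def
proof (rule the_equality)
  fix D' assume "GDERIV f x :> D'"
  then have "(\<lambda>h. inner h D') = (\<lambda>h. inner h D)"
    using assms unfolding gderiv_def by (rule has_derivative_unique)
  then show "D' = D"
    by (metis inner_commute vector_eq_ldot)
qed (fact assms)

lemma GDERIV_grad:
  assumes "\<exists>D. GDERIV f x :> D"
  shows "GDERIV f x :> grad f x"
  using assms grad_eqI by metis

lemma DERIV_along_line:
  assumes "\<And>z. GDERIV f z :> grad f z"
  shows "((\<lambda>t. f (x + t *\<^sub>R d)) has_real_derivative (grad f (x + t *\<^sub>R d) \<bullet> d)) (at t)"
proof -
  have "((\<lambda>t. x + t *\<^sub>R d) has_derivative (\<lambda>h. h *\<^sub>R d)) (at t)"
    by (auto intro!: derivative_eq_intros)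
  from has_derivative_compose[OF this assms[unfolded gderiv_def]]
  have "((\<lambda>t. f (x + t *\<^sub>R d)) has_derivative (\<lambda>h. h *\<^sub>R d \<bullet> grad f (x + t *\<^sub>R d))) (at t)" .
  moreover have "(\<lambda>h. h *\<^sub>R d \<bullet> grad f (x + t *\<^sub>R d)) = (*) (grad f (x + t *\<^sub>R d) \<bullet> d)"
    by (auto simp: inner_commute)
  ultimately show ?thesis
    by (simp add: has_field_derivative_def)
qed

lemma convex_on_grad_ineq:
  fixes f :: "'a::real_inner \<Rightarrow> real"
  assumes f: "convex_on UNIV f" and diff: "\<And>z. GDERIV f z :> grad f z"
  shows "f x + grad f x \<bullet> (y - x) \<le> f y"
proof -
  let ?q = "\<lambda>t. f (x + t *\<^sub>R (y - x))"
  have "convex_on UNIV ?q"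
  proof (rule convex_onI)
    fix t a b :: real
    assume t: "0 < t" "t < 1"
    have "x + ((1 - t) *\<^sub>R a + t *\<^sub>R b) *\<^sub>R (y - x)
        = (1 - t) *\<^sub>R (x + a *\<^sub>R (y - x)) + t *\<^sub>R (x + b *\<^sub>R (y - x))"
      by (simp add: algebra_simps)
    then show "?q ((1 - t) *\<^sub>R a + t *\<^sub>R b) \<le> (1 - t) * ?q a + t * ?q b"
      using convex_onD[OF f, of t "x + a *\<^sub>R (y - x)" "x + b *\<^sub>R (y - x)"] t by simp
  qed simp
  then have "?q 1 - ?q 0 \<ge> (grad f (x + 0 *\<^sub>R (y - x)) \<bullet> (y - x)) * (1 - 0)"
    by (rule convex_on_imp_above_tangent) (auto intro: DERIV_along_line[OF diff, of x "y - x" 0, simplified])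
  then show ?thesis by simp
qed

text \<open>
  The descent lemma: along the segment from \<open>x\<close> to \<open>y\<close>, the slope of \<open>f\<close> at time \<open>t\<close> exceeds the
  initial slope by at most \<open>L t \<parallel>y - x\<parallel>\<^sup>2\<close>, and integrating over \<open>t\<close> gives the factor \<open>L / 2\<close>.
\<close>

lemma lipschitz_grad_quadratic_bound:
  fixes f :: "'a::real_inner \<Rightarrow> real"
  assumes diff: "\<And>z. GDERIV f z :> grad f z" and lip: "L-lipschitz_on UNIV (grad f)"
  shows "f y \<le> f x + grad f x \<bullet> (y - x) + L / 2 * (norm (y - x))\<^sup>2"
proof -
  let ?d = "y - x"
  let ?q = "\<lambda>t. f (x + t *\<^sub>R ?d) - t * (grad f x \<bullet> ?d) - L / 2 * t\<^sup>2 * (norm ?d)\<^sup>2"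
  have "?q 1 \<le> ?q 0"
  proof (rule DERIV_nonpos_imp_nonincreasing[where f = ?q])
    fix t :: real assume t: "0 \<le> t" "t \<le> 1"
    let ?D = "grad f (x + t *\<^sub>R ?d) \<bullet> ?d - grad f x \<bullet> ?d - L * t * (norm ?d)\<^sup>2"
    have "(?q has_real_derivative ?D) (at t)"
      by (auto intro!: derivative_eq_intros DERIV_along_line diff)
    moreover have "?D \<le> 0"
    proof -
      have "grad f (x + t *\<^sub>R ?d) \<bullet> ?d - grad f x \<bullet> ?d
          \<le> norm (grad f (x + t *\<^sub>R ?d) - grad f x) * norm ?d"
        using norm_cauchy_schwarz[of "grad f (x + t *\<^sub>R ?d) - grad f x" ?d]
        by (simp add: inner_diff_left)
      also have "\<dots> \<le> (L * (t * norm ?d)) * norm ?d"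
        using lipschitz_onD[OF lip, of "x + t *\<^sub>R ?d" x] t
        by (intro mult_right_mono) (auto simp: dist_norm)
      finally show ?thesis by (simp add: power2_eq_square)
    qed
    ultimately show "\<exists>D. (?q has_real_derivative D) (at t) \<and> D \<le> 0" by blast
  qed simp
  then show ?thesis by simp
qed

lemma GDERIV_combination:
  fixes f1 f2 :: "'a::real_inner \<Rightarrow> real"
  assumes "GDERIV f1 x :> D1" "GDERIV f2 x :> D2"
  shows "GDERIV (\<lambda>w. s * f1 w + f2 w) x :> s *\<^sub>R D1 + D2"
  using GDERIV_add[OF GDERIV_mult[OF GDERIV_const[of s] assms(1)] assms(2)] by simp

lemma lipschitz_grad_combination:
  fixes f1 f2 :: "'a::real_inner \<Rightarrow> real"
  assumes "\<And>z. GDERIV f1 z :> grad f1 z" "\<And>z. GDERIV f2 z :> grad f2 z"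
    and lip: "L1-lipschitz_on UNIV (grad f1)" "L2-lipschitz_on UNIV (grad f2)" and "0 \<le> s"
  shows "(s * L1 + L2)-lipschitz_on UNIV (grad (\<lambda>w. s * f1 w + f2 w))"
proof -
  have "grad (\<lambda>w. s * f1 w + f2 w) = (\<lambda>z. s *\<^sub>R grad f1 z + grad f2 z)"
    by (intro ext grad_eqI GDERIV_combination assms)
  then show ?thesis
    using lipschitz_on_add[OF lipschitz_on_cmult[OF lip(1), of s] lip(2)] \<open>0 \<le> s\<close> by simp
qed

lemma smooth_convex_continuous:
  assumes "smooth_convex f"
  shows "isCont f z"
proof -
  have "GDERIV f z :> grad f z"
    using assms by (auto simp: smooth_convex_def intro: GDERIV_grad)
  then show ?thesis
    unfolding gderiv_def by (rule has_derivative_continuous)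
qed

section \<open>Extended-valued functions\<close>

text \<open>
  The lower limit in the definition is over punctured neighbourhoods. At \<open>x\<close> itself the
  inequality is the condition \<open>e < h x\<close>, so full neighbourhoods do as well; a convergent sequence,
  which may take the value \<open>x\<close>, calls for these.
\<close>

lemma lsc_fun_iff:
  "lsc_fun h \<longleftrightarrow> (\<forall>x. \<forall>e<h x. \<forall>\<^sub>F y in nhds x. e < h y)"
proof -
  have "(\<forall>\<^sub>F y in at x. e < h y) \<longleftrightarrow> (\<forall>\<^sub>F y in nhds x. e < h y)" if "e < h x" for x e
    using that by (auto simp: eventually_at_filter elim: eventually_mono)
  then show ?thesis unfolding lsc_fun_def le_Liminf_iff by blast
qed

lemma lsc_fun_LIMSEQ_le:
  assumes "lsc_fun h" "z \<longlonglongrightarrow> x" "c \<longlonglongrightarrow> b" "\<And>n. h (z n) \<le> ereal (c n)"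
  shows "h x \<le> ereal b"
proof (rule ccontr)
  assume "\<not> ?thesis"
  then obtain e where e: "ereal b < ereal e" "ereal e < h x"
    using ereal_dense2 by (metis not_le)
  have "\<forall>\<^sub>F n in sequentially. ereal e < h (z n)"
    using assms(1,2) e(2) unfolding lsc_fun_iff filterlim_iff by blast
  moreover have "\<forall>\<^sub>F n in sequentially. c n < e"
    using order_tendstoD(2)[OF assms(3)] e(1) by simp
  ultimately have "\<forall>\<^sub>F n in sequentially. False"
  proof eventually_elim
    case (elim n)
    then have "h (z n) < ereal e" using assms(4)[of n] by (auto elim: order_le_less_trans)
    with elim(1) show ?case by simp
  qed
  then show False by simp
qed

lemma lsc_fun_objective:
  fixes f :: "'a::t2_space \<Rightarrow> real"
  assumes f: "\<And>z. isCont f z" and g: "lsc_fun g"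
  shows "lsc_fun (objective f g)"
  unfolding lsc_fun_iff
proof (intro allI impI)
  fix x and e :: ereal
  assume "e < objective f g x"
  then obtain r where r: "e < ereal r" "ereal r < ereal (f x) + g x"
    unfolding objective_def using ereal_dense2 by metis
  from r(2) have "ereal (r - f x) < g x" by (cases "g x") auto
  then obtain s where s: "ereal (r - f x) < ereal s" "ereal s < g x"
    using ereal_dense2 by metis
  have "\<forall>\<^sub>F y in nhds x. ereal s < g y"
    using g s(2) unfolding lsc_fun_iff by blast
  moreover have "\<forall>\<^sub>F y in nhds x. r - s < f y"
    using f[of x] s(1)
    by (intro order_tendstoD(1)[where y = "f x"]) (auto simp: tendsto_at_iff_tendsto_nhds isCont_def)
  ultimately show "\<forall>\<^sub>F y in nhds x. e < objective f g y"
  proof eventually_elim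
    case (elim y)
    then have "ereal r \<le> ereal (f y) + g y" by (cases "g y") auto
    with r(1) show ?case by (simp add: objective_def)
  qed
qed

lemma convex_fun_objective:
  fixes f :: "'a::real_vector \<Rightarrow> real"
  assumes f: "convex_on UNIV f" and g: "convex_fun g" "\<And>z. g z \<noteq> -\<infinity>"
  shows "convex_fun (objective f g)"
  unfolding convex_fun_def objective_def
proof (intro allI impI)
  fix x y :: 'a and t :: real
  assume t: "0 < t \<and> t < 1"
  have fc: "f ((1 - t) *\<^sub>R x + t *\<^sub>R y) \<le> (1 - t) * f x + t * f y"
    using convex_onD[OF f, of t x y] t by simp
  have gc: "g ((1 - t) *\<^sub>R x + t *\<^sub>R y) \<le> ereal (1 - t) * g x + ereal t * g y"
    using g(1) t unfolding convex_fun_def by blast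
  show "ereal (f ((1 - t) *\<^sub>R x + t *\<^sub>R y)) + g ((1 - t) *\<^sub>R x + t *\<^sub>R y)
      \<le> ereal (1 - t) * (ereal (f x) + g x) + ereal t * (ereal (f y) + g y)"
    using fc gc g(2)[of x] g(2)[of y] t
    by (cases "g x"; cases "g y"; cases "g ((1 - t) *\<^sub>R x + t *\<^sub>R y)") (auto simp: algebra_simps)
qed

lemma convex_fun_wsum:
  fixes g1 g2 :: "'a::real_vector \<Rightarrow> ereal"
  assumes c: "convex_fun g1" "convex_fun g2" 
    and "\<And>z. g1 z \<noteq> -\<infinity>" "\<And>z. g2 z \<noteq> -\<infinity>" and s: "0 < s"
  shows "convex_fun (wsum s g1 g2)"
  unfolding convex_fun_def wsum_def
proof (intro allI impI)
  fix x y :: 'a and t :: real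
  assume t: "0 < t \<and> t < 1"
  let ?z = "(1 - t) *\<^sub>R x + t *\<^sub>R y"
  have c1: "g1 ?z \<le> ereal (1 - t) * g1 x + ereal t * g1 y"
   and c2: "g2 ?z \<le> ereal (1 - t) * g2 x + ereal t * g2 y"
    using c t unfolding convex_fun_def by blast+
  have "ereal s * g1 ?z + g2 ?z
      \<le> ereal s * (ereal (1 - t) * g1 x + ereal t * g1 y) + (ereal (1 - t) * g2 x + ereal t * g2 y)"
    using c1 c2 s by (intro add_mono ereal_mult_left_mono) auto
  also have "\<dots> = ereal (1 - t) * (ereal s * g1 x + g2 x) + ereal t * (ereal s * g1 y + g2 y)"
    using assms(3,4)[of x] assms(3,4)[of y] s t
    by (cases "g1 x"; cases "g1 y"; cases "g2 x"; cases "g2 y") (auto simp: algebra_simps)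
  finally show "ereal s * g1 ?z + g2 ?z \<le> \<dots>" .
qed

lemma wsum_objective:
  assumes "0 < s" "g1 z \<noteq> -\<infinity>" "g2 z \<noteq> -\<infinity>"
  shows "wsum s (objective f1 g1) (objective f2 g2) z
    = objective (\<lambda>w. s * f1 w + f2 w) (wsum s g1 g2) z"
  using assms unfolding wsum_def objective_def
  by (cases "g1 z"; cases "g2 z") (auto simp: algebra_simps)

section \<open>Proximal gradient steps\<close>

lemma prox_finite:
  assumes "p \<in> prox (\<lambda>w. ereal a * G w) u" "0 < a"
  shows "G p \<noteq> \<infinity>"
  using assms by (auto simp: prox_def argmin_on_def)

text \<open>
  Fermat's rule for the proximal mapping. Moving from \<open>p\<close> to \<open>(1 - t) p + t y\<close> lowers
  \<open>G\<close> by at least \<open>t (G p - G y)\<close>, by convexity, and changes the quadratic term by \<open>t ((p - u) \<bullet> (y - p))\<close>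
  up to an error of order \<open>t\<^sup>2\<close>; dividing by \<open>t\<close> and letting \<open>t\<close> tend to zero leaves the
  subgradient inequality.
\<close>

lemma prox_subgradient:
  fixes G :: "'a::real_inner \<Rightarrow> ereal"
  assumes G: "convex_fun G" "\<And>z. G z \<noteq> -\<infinity>" and a: "0 < a"
    and p: "p \<in> prox (\<lambda>w. ereal a * G w) u"
  shows "(1 / a) *\<^sub>R (u - p) \<in> subdiff G p"
  unfolding subdiff_def
proof (intro CollectI allI)
  fix y
  from prox_finite[OF p a] G(2) obtain c where c: "G p = ereal c"
    by (metis ereal_cases)
  show "G p + ereal (((1 / a) *\<^sub>R (u - p)) \<bullet> (y - p)) \<le> G y"
  proof (cases "G y")
    case (real b)
    have *: "a * (c - b) \<le> (p - u) \<bullet> (y - p) + t / 2 * (norm (y - p))\<^sup>2"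
      if t: "0 < t" "t < 1" for t
    proof -
      let ?w = "(1 - t) *\<^sub>R p + t *\<^sub>R y"
      have Gw: "G ?w \<le> ereal ((1 - t) * c + t * b)"
        using G(1) t unfolding convex_fun_def by (metis c real plus_ereal.simps(1) times_ereal.simps(1))
      have "ereal a * G p + ereal (1 / 2 * (norm (p - u))\<^sup>2)
          \<le> ereal a * G ?w + ereal (1 / 2 * (norm (?w - u))\<^sup>2)"
        using p unfolding prox_def argmin_on_def is_arg_min_def by (auto simp: not_less)
      also have "\<dots> \<le> ereal a * ereal ((1 - t) * c + t * b) + ereal (1 / 2 * (norm (?w - u))\<^sup>2)"
        using Gw a by (intro add_mono ereal_mult_left_mono) auto
      finally have "a * c + 1 / 2 * (norm (p - u))\<^sup>2
          \<le> a * ((1 - t) * c + t * b) + 1 / 2 * (norm (?w - u))\<^sup>2"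
        by (simp add: c)
      moreover have "?w - u = (p - u) + t *\<^sub>R (y - p)" by (simp add: algebra_simps)
      then have "(norm (?w - u))\<^sup>2
          = (norm (p - u))\<^sup>2 + 2 * t * ((p - u) \<bullet> (y - p)) + t\<^sup>2 * (norm (y - p))\<^sup>2"
        by (simp only: power2_norm_eq_inner) (simp add: inner_add inner_commute power2_eq_square algebra_simps)
      ultimately have "t * (a * (c - b)) \<le> t * ((p - u) \<bullet> (y - p) + t / 2 * (norm (y - p))\<^sup>2)"
        by (simp add: algebra_simps power2_eq_square)
      with t show ?thesis by simp
    qed
    have "a * (c - b) \<le> (p - u) \<bullet> (y - p) + 0 / 2 * (norm (y - p))\<^sup>2"
    proof (rule tendsto_lowerbound)
      show "((\<lambda>t. (p - u) \<bullet> (y - p) + t / 2 * (norm (y - p))\<^sup>2) \<longlongrightarrow>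
          (p - u) \<bullet> (y - p) + 0 / 2 * (norm (y - p))\<^sup>2) (at_right 0)"
        by (intro tendsto_intros) simp
      show "\<forall>\<^sub>F t in at_right 0. a * (c - b) \<le> (p - u) \<bullet> (y - p) + t / 2 * (norm (y - p))\<^sup>2"
        using eventually_at_right_real[OF zero_less_one] by (rule eventually_mono) (rule *; simp)
    qed simp
    then have "c - b \<le> (p - u) \<bullet> (y - p) / a" using a by (simp add: field_simps)
    moreover have "((1 / a) *\<^sub>R (u - p)) \<bullet> (y - p) = - ((p - u) \<bullet> (y - p) / a)"
      by (simp add: inner_diff_left diff_divide_distrib)
    ultimately have "c + ((1 / a) *\<^sub>R (u - p)) \<bullet> (y - p) \<le> b" by linarith
    then show ?thesis by (simp add: c real)
  qed (use G in auto)
qed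

locale proximal_gradient_step =
  fixes f :: "'a::real_inner \<Rightarrow> real" and G :: "'a \<Rightarrow> ereal" and L a :: real and x p :: 'a
  assumes convex: "convex_on UNIV f" and diff: "\<And>z. GDERIV f z :> grad f z"
    and lip: "L-lipschitz_on UNIV (grad f)"
    and G: "convex_fun G" "\<And>z. G z \<noteq> -\<infinity>"
    and a: "0 < a" and step: "p \<in> prox (\<lambda>w. ereal a * G w) (x - a *\<^sub>R grad f x)"
begin

lemma step_subgradient: "(1 / a) *\<^sub>R (x - p) - grad f x \<in> subdiff G p"
proof -
  have "(1 / a) *\<^sub>R (x - a *\<^sub>R grad f x - p) = (1 / a) *\<^sub>R (x - p) - grad f x"
    using a by (simp add: algebra_simps)
  with prox_subgradient[OF G a step] show ?thesis by simp
qed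

text \<open>
  Three first-order estimates are added: the quadratic upper bound for \<open>f\<close> between \<open>x\<close> and \<open>p\<close>, the
  gradient inequality for \<open>f\<close> between \<open>x\<close> and \<open>y\<close>, and the subgradient inequality for \<open>G\<close> between
  \<open>p\<close> and \<open>y\<close>. The gradient terms cancel, and besides \<open>L / 2 * \<parallel>p - x\<parallel>\<^sup>2\<close> there remains the inner
  product of \<open>x - p\<close> and \<open>y - p\<close>, which the polarisation identity turns into squared distances. The
  estimate is stated in the extended reals to include the points \<open>y\<close> outside the domain.
\<close>

lemma step_inequality:
  "objective f G p
      + ereal (((norm (p - y))\<^sup>2 - (norm (x - y))\<^sup>2 + (1 - a * L) * (norm (p - x))\<^sup>2) / (2 * a))
    \<le> objective f G y"
proof -
  let ?r = "((norm (p - y))\<^sup>2 - (norm (x - y))\<^sup>2 + (1 - a * L) * (norm (p - x))\<^sup>2) / (2 * a)"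
  let ?v = "((1 / a) *\<^sub>R (x - p) - grad f x) \<bullet> (y - p)"
  have "f p + ?r \<le> f y + ?v"
  proof -
    have "f p \<le> f x + grad f x \<bullet> (p - x) + L / 2 * (norm (p - x))\<^sup>2"
      by (rule lipschitz_grad_quadratic_bound[OF diff lip])
    moreover have "f x + grad f x \<bullet> (y - x) \<le> f y"
      by (rule convex_on_grad_ineq[OF convex diff])
    moreover have "?v = (x - p) \<bullet> (y - p) / a - grad f x \<bullet> (y - p)"
      by (simp add: inner_diff_left diff_divide_distrib)
    moreover have "grad f x \<bullet> (y - p) = grad f x \<bullet> (y - x) - grad f x \<bullet> (p - x)"
      by (simp add: inner_diff_right)
    moreover have "2 * ((x - p) \<bullet> (y - p))
        = (norm (p - y))\<^sup>2 - (norm (x - y))\<^sup>2 + (norm (p - x))\<^sup>2"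
      by (simp add: power2_norm_eq_inner inner_diff inner_commute)
    then have "?r = (x - p) \<bullet> (y - p) / a - L / 2 * (norm (p - x))\<^sup>2"
      using a by (simp add: field_simps)
    ultimately show ?thesis by linarith
  qed
  moreover have "G p + ereal ?v \<le> G y"
    using step_subgradient unfolding subdiff_def by simp
  ultimately show ?thesis
    unfolding objective_def using G(2)[of p] G(2)[of y]
    by (cases "G p"; cases "G y") auto
qed

text \<open>
  In the subgradient of \<open>G\<close> at \<open>p\<close> the gradient of \<open>f\<close> is taken at the old point \<open>x\<close>; adding
  \<open>grad f p\<close> gives a subgradient of the sum, and leaves the difference of the two gradients, which
  the Lipschitz condition controls.
\<close>

lemma objective_subgradient:
  "(1 / a) *\<^sub>R (x - p) - grad f x + grad f p \<in> subdiff (objective f G) p"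
  unfolding subdiff_def
proof (intro CollectI allI)
  fix y
  let ?v = "((1 / a) *\<^sub>R (x - p) - grad f x) \<bullet> (y - p)"
  have "f p + grad f p \<bullet> (y - p) \<le> f y"
    by (rule convex_on_grad_ineq[OF convex diff])
  moreover have "G p + ereal ?v \<le> G y"
    using step_subgradient unfolding subdiff_def by simp
  ultimately show "objective f G p
      + ereal (((1 / a) *\<^sub>R (x - p) - grad f x + grad f p) \<bullet> (y - p)) \<le> objective f G y"
    unfolding objective_def inner_add_left using G(2)[of p] G(2)[of y]
    by (cases "G p"; cases "G y") auto
qed

lemma edist_subdiff_le:
  "edist_set 0 (subdiff (objective f G) p) \<le> ereal ((1 / a + L) * norm (p - x))"
proof -
  let ?v = "(1 / a) *\<^sub>R (x - p) - grad f x + grad f p"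
  have "norm ?v \<le> norm ((1 / a) *\<^sub>R (x - p)) + norm (grad f p - grad f x)"
    using norm_triangle_ineq[of "(1 / a) *\<^sub>R (x - p)" "grad f p - grad f x"]
    by (simp add: algebra_simps)
  also have "\<dots> \<le> (1 / a + L) * norm (p - x)"
    using lipschitz_onD[OF lip, of p x] a
    by (simp add: dist_norm norm_minus_commute distrib_right)
  finally have "ereal (norm (?v - 0)) \<le> ereal ((1 / a + L) * norm (p - x))" by simp
  with objective_subgradient show ?thesis
    unfolding edist_set_def by (rule INF_lower2)
qed

end

section \<open>Sublevel sets and the bilevel solution set\<close>

lemma infdist_lessE:
  assumes "infdist y S < e" "S \<noteq> {}"
  obtains w where "w \<in> S" "dist y w < e"
  using assms by (auto simp: infdist_notempty cINF_less_iff)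

lemma bounded_infdist_le:
  fixes z :: "'i \<Rightarrow> 'a::real_normed_vector"
  assumes "bounded S" "S \<noteq> {}" "\<And>n. n \<in> I \<Longrightarrow> infdist (z n) S \<le> e"
  shows "bounded (z ` I)"
proof -
  obtain B where B: "\<And>w. w \<in> S \<Longrightarrow> norm w \<le> B"
    using assms(1) unfolding bounded_iff by blast
  have "norm (z n) \<le> B + (e + 1)" if n: "n \<in> I" for n
  proof -
    from assms(3)[OF n] have "infdist (z n) S < e + 1" by linarith
    then obtain w where "w \<in> S" "dist (z n) w < e + 1" using assms(2) by (rule infdist_lessE)
    then show ?thesis
      using B[of w] norm_triangle_sub[of "z n" w] by (simp add: dist_norm)
  qed
  then show ?thesis unfolding bounded_iff by blast
qed

lemma convex_fun_segment_le:
  assumes "convex_fun h" "h x \<le> ereal c" "h y \<le> ereal (c + e)" "0 \<le> e" "0 < t" "t < 1"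
  shows "h ((1 - t) *\<^sub>R x + t *\<^sub>R y) \<le> ereal (c + e)"
proof -
  have "h ((1 - t) *\<^sub>R x + t *\<^sub>R y) \<le> ereal (1 - t) * h x + ereal t * h y"
    using assms unfolding convex_fun_def by blast
  also have "\<dots> \<le> ereal (1 - t) * ereal c + ereal t * ereal (c + e)"
    using assms by (intro add_mono ereal_mult_left_mono) auto
  also have "\<dots> \<le> ereal (c + e)"
  proof -
    have "(1 - t) * e \<ge> 0" using assms by simp
    then show ?thesis by (simp add: algebra_simps)
  qed
  finally show ?thesis .
qed

text \<open>
  Convexity turns boundedness of \<open>S\<close> into boundedness and stability of the slightly relaxed
  sublevel sets. Points of vanishing relaxation that stayed at distance more than \<open>e\<close> might run
  off to infinity; but the segments from a point of \<open>S\<close> to them contain points at distance exactly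
  \<open>e\<close>, which satisfy the same relaxed bounds by convexity. The points at distance \<open>e\<close> form a
  bounded set, so a subsequence has a limit. By lower semicontinuity it belongs
  to \<open>S\<close>, although its distance to \<open>S\<close> is \<open>e\<close>.
\<close>

lemma sublevel_set_stable:
  fixes h1 h2 :: "'a::euclidean_space \<Rightarrow> ereal" and p q :: real
  assumes S_def: "S = {z. h1 z \<le> ereal p \<and> h2 z \<le> ereal q}"
    and h1: "convex_fun h1" "lsc_fun h1" and h2: "convex_fun h2" "lsc_fun h2"
    and S: "S \<noteq> {}" "bounded S" and e: "0 < e"
  obtains d where "0 < d"
    "\<And>y. h1 y \<le> ereal (p + d) \<Longrightarrow> h2 y \<le> ereal (q + d) \<Longrightarrow> infdist y S \<le> e"
proof -
  have "\<exists>d>0. \<forall>y. h1 y \<le> ereal (p + d) \<longrightarrow> h2 y \<le> ereal (q + d) \<longrightarrow> infdist y S \<le> e"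
  proof (rule ccontr)
    assume contra: "\<not> ?thesis"
    define d where "d = (\<lambda>n. 1 / real (Suc n))"
    have dpos: "0 < d n" for n by (simp add: d_def)
    obtain s where s: "s \<in> S" using S by blast
    have "\<exists>z. h1 z \<le> ereal (p + d n) \<and> h2 z \<le> ereal (q + d n) \<and> infdist z S = e" for n
    proof -
      from contra dpos[of n] obtain y where
        y: "h1 y \<le> ereal (p + d n)" "h2 y \<le> ereal (q + d n)" "e < infdist y S"
        by (auto simp: not_le)
      let ?z = "\<lambda>t::real. (1 - t) *\<^sub>R s + t *\<^sub>R y"
      have "\<exists>t\<ge>0. t \<le> 1 \<and> infdist (?z t) S = e"
        using s e y(3) by (intro IVT') (auto intro!: continuous_intros)
      then obtain t where t: "0 \<le> t" "t \<le> 1" "infdist (?z t) S = e" by blast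
      have "t \<noteq> 0" "t \<noteq> 1" using t(3) s e y(3) by auto
      with t have "0 < t" "t < 1" by auto
      then have "h1 (?z t) \<le> ereal (p + d n)" "h2 (?z t) \<le> ereal (q + d n)"
        using s y dpos[of n] h1(1) h2(1) unfolding S_def
        by (auto intro!: convex_fun_segment_le)
      with t(3) show ?thesis by blast
    qed
    then obtain z where z: "\<And>n. h1 (z n) \<le> ereal (p + d n)" "\<And>n. h2 (z n) \<le> ereal (q + d n)"
      "\<And>n. infdist (z n) S = e" by metis
    have "bounded (range z)"
      using S by (intro bounded_infdist_le[where e = e]) (auto simp: z(3))
    then obtain l r where r: "strict_mono r" "(z \<circ> r) \<longlonglongrightarrow> l"
      using bounded_imp_convergent_subsequence by blast
    have "d \<longlonglongrightarrow> 0" unfolding d_def by real_asymp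
    from LIMSEQ_subseq_LIMSEQ[OF this r(1)] have dr: "(d \<circ> r) \<longlonglongrightarrow> 0" .
    have "h1 l \<le> ereal p"
      using lsc_fun_LIMSEQ_le[OF h1(2) r(2), of "\<lambda>n. p + (d \<circ> r) n" p] z(1)
        tendsto_add[OF tendsto_const dr, of p] by simp
    moreover have "h2 l \<le> ereal q"
      using lsc_fun_LIMSEQ_le[OF h2(2) r(2), of "\<lambda>n. q + (d \<circ> r) n" q] z(2)
        tendsto_add[OF tendsto_const dr, of q] by simp
    ultimately have "infdist l S = 0" by (simp add: S_def)
    moreover have "(\<lambda>n. infdist ((z \<circ> r) n) S) \<longlonglongrightarrow> infdist l S"
      using r(2) by (rule tendsto_infdist)
    then have "infdist l S = e" by (simp add: z(3) LIMSEQ_const_iff)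
    ultimately show False using e by simp
  qed
  with that show ?thesis by blast
qed

lemma argmin_onD:
  assumes "z \<in> argmin_on h A"
  shows "z \<in> A" "h z < \<infinity>" "\<And>w. w \<in> A \<Longrightarrow> h z \<le> h w"
  using assms by (auto simp: argmin_on_def is_arg_min_def not_less)

lemma argmin_on_eq_sublevel:
  assumes "z \<in> argmin_on h A"
  shows "argmin_on h A = {y \<in> A. h y \<le> h z}"
proof -
  have "y \<in> argmin_on h A \<longleftrightarrow> y \<in> A \<and> h y \<le> h z" for y
    using argmin_onD[OF assms] by (auto simp: argmin_on_def is_arg_min_def not_less dest: order_trans)
  then show ?thesis by auto
qed

text \<open>
  This description as a joint sublevel set removes the nesting of the two minimisations, and is
  what makes \<open>sublevel_set_stable\<close> applicable to the solution set.
\<close>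

lemma bilevel_solutions_eq_sublevel:
  assumes z: "z \<in> bilevel_solutions h1 h2"
  shows "bilevel_solutions h1 h2 = {y. h1 y \<le> h1 z \<and> h2 y \<le> h2 z}"
proof -
  have "z \<in> argmin_on h2 UNIV"
    using z unfolding bilevel_solutions_def by (rule argmin_onD)
  then have "argmin_on h2 UNIV = {y. h2 y \<le> h2 z}"
    using argmin_on_eq_sublevel by fastforce
  then show ?thesis
    using argmin_on_eq_sublevel[OF z[unfolded bilevel_solutions_def]]
    by (auto simp: bilevel_solutions_def)
qed

section \<open>Penalised Fejer sequences and telescoping\<close>

lemma infdist_mono_pointwise:
  assumes "\<And>z. z \<in> S \<Longrightarrow> dist y z \<le> dist x z"
  shows "infdist y S \<le> infdist x S"
proof (cases "S = {}")
  case False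
  then show ?thesis
    unfolding infdist_notempty[OF False]
    using assms by (intro cINF_mono) (auto intro: bdd_belowI[where m = 0])
qed (simp add: infdist_def)

text \<open>
  The convergence argument, freed of the optimisation problem. The sequences \<open>a\<close> and \<open>b\<close> are the
  values of the two objectives at the iterate with index \<open>Suc k\<close>, and \<open>\<delta> = \<sigma> (a - p) + (b - q)\<close> is the
  penalised gap, whose sign is not known. Steps with \<open>\<delta> > d \<sigma>\<close> do not increase the distance to \<open>S\<close>;
  late steps with \<open>\<delta> \<le> d \<sigma>\<close> end close to \<open>S\<close>; and steps of the second kind cannot cease, for then
  \<open>c d \<Sum>\<sigma>\<close> would be bounded by a telescoping sum of squared distances.
\<close>

lemma penalised_fejer_convergence:
  fixes x :: "nat \<Rightarrow> 'a::metric_space" and \<sigma> \<alpha> a b :: "nat \<Rightarrow> real" and p q u c :: real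
  assumes S: "S \<noteq> {}"
    and \<sigma>: "\<And>k. 0 < \<sigma> k" "\<sigma> \<longlonglongrightarrow> 0" "\<not> summable \<sigma>"
    and \<alpha>: "0 < c" "\<And>k. c \<le> \<alpha> k"
    and step: "\<And>k z. z \<in> S \<Longrightarrow>
      \<alpha> k * (\<sigma> k * (a k - p) + (b k - q)) \<le> (dist (x k) z)\<^sup>2 - (dist (x (Suc k)) z)\<^sup>2"
    and lower: "\<And>k. u \<le> a k" "\<And>k. q \<le> b k"
    and stable: "\<And>e. 0 < e \<Longrightarrow>
      \<exists>d>0. \<forall>k. a k \<le> p + d \<longrightarrow> b k \<le> q + d \<longrightarrow> infdist (x (Suc k)) S \<le> e"
  shows "(\<lambda>k. infdist (x k) S) \<longlonglongrightarrow> 0"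
proof (rule LIMSEQ_I)
  fix e :: real assume "0 < e"
  then obtain d where d: "0 < d"
    and near_d: "\<And>k. a k \<le> p + d \<Longrightarrow> b k \<le> q + d \<Longrightarrow> infdist (x (Suc k)) S \<le> e / 2"
    using stable[of "e / 2"] by auto
  define \<delta> where "\<delta> k = \<sigma> k * (a k - p) + (b k - q)" for k
  have \<alpha>pos: "0 < \<alpha> k" for k using \<alpha>(1) \<alpha>(2)[of k] by linarith

  \<comment> \<open>If \<open>\<delta> \<le> d \<sigma>\<close>, then \<open>b - q \<le> \<sigma> (d + p - u)\<close>; beyond \<open>N\<close> this is below \<open>d\<close>.\<close>
  have "(\<lambda>k. \<sigma> k * (d + p - u)) \<longlonglongrightarrow> 0"
    using tendsto_mult_right[OF \<sigma>(2), of "d + p - u"] by simp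
  then have "\<forall>\<^sub>F k in sequentially. \<sigma> k * (d + p - u) < d"
    using d by (rule order_tendstoD)
  then obtain N where N: "\<And>k. N \<le> k \<Longrightarrow> \<sigma> k * (d + p - u) < d"
    unfolding eventually_sequentially by blast

  have near: "infdist (x (Suc k)) S \<le> e / 2" if k: "N \<le> k" "\<delta> k \<le> d * \<sigma> k" for k
  proof (rule near_d)
    have "\<sigma> k * (a k - p) \<le> \<sigma> k * d"
      using k(2) lower(2)[of k] by (simp add: \<delta>_def mult.commute)
    then show "a k \<le> p + d" using \<sigma>(1)[of k] by simp
    have "\<sigma> k * (u - p) \<le> \<sigma> k * (a k - p)"
      using \<sigma>(1)[of k] lower(1)[of k] by simp
    with k(2) have "b k - q \<le> \<sigma> k * (d + p - u)"
      by (simp add: \<delta>_def algebra_simps)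
    with N[OF k(1)] show "b k \<le> q + d" by linarith
  qed
  have fejer: "dist (x (Suc k)) z \<le> dist (x k) z" if "d * \<sigma> k < \<delta> k" "z \<in> S" for k z
  proof -
    have "0 < \<delta> k" using that(1) d \<sigma>(1)[of k] by (meson less_trans mult_pos_pos)
    then have "0 \<le> \<alpha> k * \<delta> k" using \<alpha>pos[of k] by simp
    with step[OF that(2), of k] have "(dist (x (Suc k)) z)\<^sup>2 \<le> (dist (x k) z)\<^sup>2"
      unfolding \<delta>_def by linarith
    from this zero_le_dist show ?thesis by (rule power2_le_imp_le)
  qed

  \<comment> \<open>The divergence of the sum of the \<open>\<sigma> k\<close> enters here.\<close>
  have "\<exists>M\<ge>N. \<delta> M \<le> d * \<sigma> M"
  proof (rule ccontr)
    assume contra: "\<not> ?thesis"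
    have far: "d * \<sigma> k < \<delta> k" if "N \<le> k" for k using contra that by (meson not_le)
    obtain z where z: "z \<in> S" using S by blast
    define D where "D k = (dist (x (k + N)) z)\<^sup>2" for k
    have "decseq D"
      unfolding decseq_Suc_iff D_def using fejer[OF far z] by (auto intro: power_mono)
    then obtain l where "D \<longlonglongrightarrow> l"
      using decseq_convergent[of D 0] by (auto simp: D_def)
    then have "summable (\<lambda>k. D k - D (Suc k))" by (rule telescope_summable')
    then have "summable (\<lambda>k. c * d * \<sigma> (k + N))"
    proof (rule summable_comparison_test')
      fix k :: nat
      have "c * (d * \<sigma> (k + N)) \<le> \<alpha> (k + N) * \<delta> (k + N)"
        using far[of "k + N"] \<alpha>(1) \<alpha>(2)[of "k + N"] d \<sigma>(1)[of "k + N"]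
        by (intro mult_mono) auto
      also have "\<dots> \<le> D k - D (Suc k)"
        using step[OF z, of "k + N"] by (simp add: D_def \<delta>_def)
      finally show "norm (c * d * \<sigma> (k + N)) \<le> D k - D (Suc k)"
        using \<alpha>(1) d \<sigma>(1)[of "k + N"] by (simp add: abs_mult)
    qed
    then have "summable \<sigma>"
      using \<alpha>(1) d by (simp add: summable_cmult_iff summable_iff_shift)
    with \<sigma>(3) show False ..
  qed
  then obtain M where M: "N \<le> M" "\<delta> M \<le> d * \<sigma> M" by blast

  have "infdist (x n) S \<le> e / 2" if "Suc M \<le> n" for n
    using that
  proof (induction n rule: dec_induct)
    case base
    show ?case by (rule near[OF M])
  next
    case (step n)
    show ?case
    proof (cases "\<delta> n \<le> d * \<sigma> n")
      case True
      then show ?thesis using near step.hyps M(1) by simp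
    next
      case False
      then have "infdist (x (Suc n)) S \<le> infdist (x n) S"
        using fejer by (intro infdist_mono_pointwise) simp
      with step.IH show ?thesis by linarith
    qed
  qed
  then show "\<exists>no. \<forall>n\<ge>no. norm (infdist (x n) S - 0) < e"
    using \<open>0 < e\<close> by (intro exI[of _ "Suc M"]) (force simp: infdist_nonneg)
qed

lemma telescoping_small_term:
  fixes D E :: "nat \<Rightarrow> real"
  assumes "\<And>k. D k \<le> E k - E (Suc k)" "\<And>k. 0 \<le> E k"
  shows "\<exists>k\<le>K. D k \<le> E 0 / (1 + real K)"
proof (rule ccontr)
  assume contra: "\<not> ?thesis"
  have "E 0 / (1 + real K) < D k" if "k \<le> K" for k
    using contra that by (meson not_le)
  then have "(\<Sum>k<Suc K. E 0 / (1 + real K)) < (\<Sum>k<Suc K. D k)"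
    by (intro sum_strict_mono) auto
  also have "\<dots> \<le> (\<Sum>k<Suc K. E k - E (Suc k))"
    by (intro sum_mono assms)
  also have "\<dots> = E 0 - E (Suc K)" by (rule sum_lessThan_telescope')
  also have "\<dots> \<le> E 0" using assms(2) by simp
  finally show False by (simp add: field_simps)
qed

section \<open>The staBiM iteration\<close>

lemma ereal_finite_combination:
  assumes "ereal s * v + w \<noteq> \<infinity>" "0 < s" "v \<noteq> -\<infinity>" "w \<noteq> -\<infinity>"
  shows "\<bar>v\<bar> \<noteq> \<infinity>" "\<bar>w\<bar> \<noteq> \<infinity>"
  using assms by (cases v; cases w; auto)+

text \<open>
  The numbers \<open>p\<close>, \<open>q\<close> and \<open>u\<close> below are real versions of extended values that turn out to be
  finite (\<open>optimal_values\<close>), and \<open>p\<close> and \<open>q\<close> do not depend on the chosen solution. The data \<open>L\<close>, \<open>\<alpha>\<close>,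
  \<open>f\<close> and \<open>G\<close> with index \<open>k\<close> belong to the step from \<open>x k\<close> to \<open>x (Suc k)\<close>, which uses the weight
  \<open>\<sigma> (Suc k)\<close>. The values \<open>a k\<close> and \<open>b k\<close> are meaningful for positive \<open>k\<close> (\<open>iterate_values\<close>), whereas
  the starting point may lie outside the domains.
\<close>

locale stabim_iteration =
  fixes f1 f2 :: "real ^ 'n \<Rightarrow> real" and g1 g2 :: "real ^ 'n \<Rightarrow> ereal"
    and L1 L2 \<nu> :: real and \<sigma> :: "nat \<Rightarrow> real" and x :: "nat \<Rightarrow> real ^ 'n"
  assumes basic: "basic_assumption f1 f2 g1 g2"
    and lip1: "L1-lipschitz_on UNIV (grad f1)"
    and lip2: "L2-lipschitz_on UNIV (grad f2)"
    and L_pos: "0 < L1 + L2"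
    and alg: "staBiM f1 f2 g1 g2 L1 L2 \<nu> \<sigma> x"
begin

definition "\<phi>1 = objective f1 g1"
definition "\<phi>2 = objective f2 g2"
definition "solutions = bilevel_solutions \<phi>1 \<phi>2"
definition "p = real_of_ereal (\<phi>1 (SOME z. z \<in> solutions))"
definition "q = real_of_ereal (\<phi>2 (SOME z. z \<in> solutions))"
definition "u = real_of_ereal (upper_inf \<phi>1 \<phi>2)"
definition "L k = \<sigma> (Suc k) * L1 + L2"
definition "\<alpha> k = \<nu> / L k"
definition "f k = (\<lambda>w. \<sigma> (Suc k) * f1 w + f2 w)"
definition "G k = wsum (\<sigma> (Suc k)) g1 g2"
definition "a k = real_of_ereal (\<phi>1 (x k))"
definition "b k = real_of_ereal (\<phi>2 (x k))"

lemma \<nu>: "0 < \<nu>" "\<nu> < 1"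
  using alg by (auto simp: staBiM_def)

lemma \<sigma>_Suc: "3 / 4 * \<sigma> k \<le> \<sigma> (Suc k)" "\<sigma> (Suc k) \<le> \<sigma> k"
  using alg by (auto simp: staBiM_def)

lemma \<sigma>_pos: "0 < \<sigma> k"
proof (induction k)
  case 0
  show ?case using alg by (auto simp: staBiM_def)
next
  case (Suc k)
  then show ?case using \<sigma>_Suc(1)[of k] by simp
qed

lemma \<sigma>_le: "\<sigma> k \<le> \<sigma> 0"
  using \<sigma>_Suc(2) by (induction k) (auto intro: order_trans)

lemma L_nonneg: "0 \<le> L1" "0 \<le> L2"
  using lip1 lip2 by (auto dest: lipschitz_on_nonneg)

lemma L_gt_0: "0 < L k"
  using L_pos L_nonneg \<sigma>_pos[of "Suc k"] unfolding L_def
  by (cases "L1 = 0") (auto intro: add_pos_nonneg)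

lemma L_le: "L k \<le> \<sigma> 0 * L1 + L2"
  unfolding L_def using \<sigma>_le[of "Suc k"] L_nonneg by (simp add: mult_right_mono)

lemma \<alpha>_pos: "0 < \<alpha> k"
  using \<nu> L_gt_0[of k] by (simp add: \<alpha>_def)

lemma \<alpha>_L: "\<alpha> k * L k = \<nu>"
  using L_gt_0[of k] by (simp add: \<alpha>_def)

lemma smooth: "smooth_convex f1" "smooth_convex f2"
  using basic by (auto simp: basic_assumption_def)

lemma GDERIV_f12: "GDERIV f1 z :> grad f1 z" "GDERIV f2 z :> grad f2 z"
  using smooth by (auto simp: smooth_convex_def intro: GDERIV_grad)

lemma g_proper: "g1 z \<noteq> -\<infinity>" "g2 z \<noteq> -\<infinity>"
  using basic by (auto simp: basic_assumption_def proper_fun_def)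

lemma \<phi>_proper: "\<phi>1 z \<noteq> -\<infinity>" "\<phi>2 z \<noteq> -\<infinity>"
  using g_proper[of z] by (auto simp: \<phi>1_def \<phi>2_def objective_def)

lemma convex_\<phi>: "convex_fun \<phi>1" "convex_fun \<phi>2"
  and lsc_\<phi>: "lsc_fun \<phi>1" "lsc_fun \<phi>2"
  using basic g_proper smooth_convex_continuous[OF smooth(1)] smooth_convex_continuous[OF smooth(2)]
  unfolding \<phi>1_def \<phi>2_def
  by (auto simp: basic_assumption_def smooth_convex_def
      intro!: convex_fun_objective lsc_fun_objective)

lemma solutions: "solutions \<noteq> {}" "bounded solutions"
  using basic by (auto simp: basic_assumption_def solutions_def \<phi>1_def \<phi>2_def)

lemma optimal_values:
  shows "solutions = {z. \<phi>1 z \<le> ereal p \<and> \<phi>2 z \<le> ereal q}" (is ?sub)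
    and "\<And>z. z \<in> solutions \<Longrightarrow> \<phi>1 z = ereal p \<and> \<phi>2 z = ereal q"
    and "lower_inf \<phi>2 = ereal q"
    and "upper_inf \<phi>1 \<phi>2 = ereal u"
proof -
  define s where "s = (SOME z. z \<in> solutions)"
  have s: "s \<in> solutions" using solutions(1) by (auto simp: s_def some_in_eq)
  note s1 = argmin_onD[OF s[unfolded solutions_def bilevel_solutions_def]]
  note s2 = argmin_onD[OF s1(1)]
  have val: "\<phi>1 s = ereal p" "\<phi>2 s = ereal q"
    using s1(2) s2(2) \<phi>_proper[of s] by (auto simp: p_def q_def s_def[symmetric] ereal_real)
  show sub: ?sub
    using bilevel_solutions_eq_sublevel[OF s[unfolded solutions_def]] val by (simp add: solutions_def)
  show "\<phi>1 z = ereal p \<and> \<phi>2 z = ereal q" if z: "z \<in> solutions" for z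
  proof -
    note z1 = argmin_onD[OF z[unfolded solutions_def bilevel_solutions_def]]
    have "ereal p \<le> \<phi>1 z" "ereal q \<le> \<phi>2 z"
      using s1(3)[OF z1(1)] s2(3)[of z] val by simp_all
    with z show ?thesis by (auto simp: sub intro: antisym)
  qed
  show "lower_inf \<phi>2 = ereal q"
    unfolding lower_inf_def using s2(3) val INF_lower[of s UNIV \<phi>2]
    by (intro antisym INF_greatest) auto
  \<comment> \<open>Finite from above by a solution, from below by the basic assumption.\<close>
  have "upper_inf \<phi>1 \<phi>2 \<le> \<phi>1 s"
    unfolding upper_inf_def using s2(2) by (intro INF_lower) (simp add: effdom_def)
  moreover have "upper_inf \<phi>1 \<phi>2 > -\<infinity>"
    using basic by (auto simp: basic_assumption_def \<phi>1_def \<phi>2_def)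
  ultimately show "upper_inf \<phi>1 \<phi>2 = ereal u"
    unfolding u_def using val by (cases "upper_inf \<phi>1 \<phi>2") auto
qed

lemma lower_bounds: "ereal q \<le> \<phi>2 z" "\<phi>2 z < \<infinity> \<Longrightarrow> ereal u \<le> \<phi>1 z"
  using optimal_values(3,4) unfolding lower_inf_def upper_inf_def
  by (metis INF_lower UNIV_I, metis (no_types, lifting) INF_lower effdom_def mem_Collect_eq)

lemma step: "proximal_gradient_step (f k) (G k) (L k) (\<alpha> k) (x k) (x (Suc k))"
proof
  show "convex_on UNIV (f k)"
    using smooth \<sigma>_pos[of "Suc k"] unfolding f_def
    by (intro convex_on_add convex_on_cmul) (auto simp: smooth_convex_def)
  show "GDERIV (f k) z :> grad (f k) z" for z
    unfolding f_def by (rule GDERIV_grad, rule exI, rule GDERIV_combination[OF GDERIV_f12])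
  show "(L k)-lipschitz_on UNIV (grad (f k))"
    unfolding L_def f_def using \<sigma>_pos[of "Suc k"]
    by (intro lipschitz_grad_combination GDERIV_f12 lip1 lip2) simp
  show "convex_fun (G k)"
    unfolding G_def using basic g_proper \<sigma>_pos
    by (intro convex_fun_wsum) (auto simp: basic_assumption_def)
  show "G k z \<noteq> -\<infinity>" for z
    using g_proper[of z] \<sigma>_pos[of "Suc k"]
    by (cases "g1 z"; cases "g2 z") (auto simp: G_def wsum_def)
  show "x (Suc k) \<in> prox (\<lambda>w. ereal (\<alpha> k) * G k w) (x k - \<alpha> k *\<^sub>R grad (f k) (x k))"
    using alg by (simp add: staBiM_def Let_def stabim_step_def \<alpha>_def L_def f_def G_def)
qed (rule \<alpha>_pos)

lemma wsum_\<phi>: "wsum (\<sigma> (Suc k)) \<phi>1 \<phi>2 = objective (f k) (G k)"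
  unfolding \<phi>1_def \<phi>2_def f_def G_def using g_proper \<sigma>_pos by (intro ext wsum_objective)

lemma iterate_values: "\<phi>1 (x (Suc k)) = ereal (a (Suc k))" "\<phi>2 (x (Suc k)) = ereal (b (Suc k))"
proof -
  interpret proximal_gradient_step "f k" "G k" "L k" "\<alpha> k" "x k" "x (Suc k)" by (rule step)
  have "wsum (\<sigma> (Suc k)) \<phi>1 \<phi>2 (x (Suc k)) \<noteq> \<infinity>"
    using prox_finite[OF step a] by (simp add: wsum_\<phi> objective_def)
  then have "\<bar>\<phi>1 (x (Suc k))\<bar> \<noteq> \<infinity>" "\<bar>\<phi>2 (x (Suc k))\<bar> \<noteq> \<infinity>"
    unfolding wsum_def using \<sigma>_pos \<phi>_proper by (auto dest: ereal_finite_combination)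
  then show "\<phi>1 (x (Suc k)) = ereal (a (Suc k))" "\<phi>2 (x (Suc k)) = ereal (b (Suc k))"
    by (auto simp: a_def b_def ereal_real)
qed

lemma iterate_lower_bounds: "u \<le> a (Suc k)" "q \<le> b (Suc k)"
  using lower_bounds[of "x (Suc k)"] by (auto simp: iterate_values)

lemma iterate_inequality:
  assumes "\<phi>1 y = ereal c" "\<phi>2 y = ereal d"
  shows "2 * \<alpha> k * (\<sigma> (Suc k) * (a (Suc k) - c) + (b (Suc k) - d))
    \<le> (norm (x k - y))\<^sup>2 - (norm (x (Suc k) - y))\<^sup>2 - (1 - \<nu>) * (norm (x (Suc k) - x k))\<^sup>2"
proof -
  interpret proximal_gradient_step "f k" "G k" "L k" "\<alpha> k" "x k" "x (Suc k)" by (rule step)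
  let ?r = "(norm (x (Suc k) - y))\<^sup>2 - (norm (x k - y))\<^sup>2 + (1 - \<nu>) * (norm (x (Suc k) - x k))\<^sup>2"
  have "\<sigma> (Suc k) * a (Suc k) + b (Suc k) + ?r / (2 * \<alpha> k) \<le> \<sigma> (Suc k) * c + d"
    using step_inequality[of y] assms
    by (simp add: wsum_\<phi>[symmetric] wsum_def iterate_values \<alpha>_L)
  then have "\<sigma> (Suc k) * (a (Suc k) - c) + (b (Suc k) - d) \<le> - ?r / (2 * \<alpha> k)"
    by (simp add: algebra_simps diff_divide_distrib add_divide_distrib)
  then show ?thesis
    using \<alpha>_pos[of k] by (subst mult.commute) (simp add: pos_le_divide_eq)
qed

text \<open>
  As the weights do not exceed \<open>\<sigma> 0\<close>, the step sizes are at least \<open>\<nu> / (\<sigma> 0 * L1 + L2)\<close>. The convergence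
  argument works with this lower bound alone, and thus covers the case \<open>L2 = 0\<close>, in which the step
  sizes tend to infinity.
\<close>

lemma infdist_tendsto_0:
  assumes "\<sigma> \<longlonglongrightarrow> 0" "\<not> summable \<sigma>"
  shows "(\<lambda>k. infdist (x k) solutions) \<longlonglongrightarrow> 0"
proof (rule penalised_fejer_convergence[where \<sigma> = "\<lambda>k. \<sigma> (Suc k)" and \<alpha> = "\<lambda>k. 2 * \<alpha> k"
      and a = "\<lambda>k. a (Suc k)" and b = "\<lambda>k. b (Suc k)" and p = p and q = q and u = u])
  show "0 < 2 * (\<nu> / (\<sigma> 0 * L1 + L2))"
    using \<nu> L_gt_0[of 0] L_le[of 0] by simp
  show "2 * (\<nu> / (\<sigma> 0 * L1 + L2)) \<le> 2 * \<alpha> k" for k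
    using \<nu> L_gt_0[of k] L_le[of k] by (simp add: \<alpha>_def frac_le)
  show "2 * \<alpha> k * (\<sigma> (Suc k) * (a (Suc k) - p) + (b (Suc k) - q))
      \<le> (dist (x k) z)\<^sup>2 - (dist (x (Suc k)) z)\<^sup>2" if "z \<in> solutions" for k z
  proof -
    have "\<phi>1 z = ereal p" "\<phi>2 z = ereal q" using optimal_values(2)[OF that] by auto
    from iterate_inequality[OF this, of k] show ?thesis
      using \<nu> by (simp add: dist_norm) (smt (verit) mult_nonneg_nonneg zero_le_power2)
  qed
  show "\<exists>d>0. \<forall>k. a (Suc k) \<le> p + d \<longrightarrow> b (Suc k) \<le> q + d \<longrightarrow> infdist (x (Suc k)) solutions \<le> e"
    if e: "0 < e" for e
  proof -
    obtain d where "0 < d" "\<And>y. \<phi>1 y \<le> ereal (p + d) \<Longrightarrow> \<phi>2 y \<le> ereal (q + d) \<Longrightarrow> infdist y solutions \<le> e"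
      using sublevel_set_stable[OF optimal_values(1) convex_\<phi>(1) lsc_\<phi>(1) convex_\<phi>(2) lsc_\<phi>(2)
          solutions e] by blast
    then show ?thesis by (intro exI[of _ d]) (simp add: iterate_values)
  qed
qed (use assms solutions \<sigma>_pos iterate_lower_bounds in \<open>auto simp: LIMSEQ_Suc summable_Suc_iff\<close>)

text \<open>
  The step inequality with \<open>y = x k\<close> compares the two iterates under the same weight \<open>\<sigma> (Suc k)\<close>.
  Replacing it by \<open>\<sigma> k\<close> at the old iterate does no harm, because \<open>\<phi>1\<close> is shifted by its lower
  bound \<open>u\<close>, so that the weighted term is nonnegative.
\<close>

lemma descent:
  assumes "\<phi>1 (x k) = ereal (a k)" "\<phi>2 (x k) = ereal (b k)"
  shows "(1 - \<nu>) / \<alpha> k * (norm (x (Suc k) - x k))\<^sup>2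
    \<le> (\<sigma> k * (a k - u) + (b k - q)) - (\<sigma> (Suc k) * (a (Suc k) - u) + (b (Suc k) - q))"
proof -
  let ?n = "(norm (x (Suc k) - x k))\<^sup>2"
  let ?r = "\<sigma> (Suc k) * (a k - a (Suc k)) + (b k - b (Suc k))"
  have "(1 - \<nu>) * ?n \<le> \<alpha> k * ?r"
  proof -
    \<comment> \<open>With \<open>y = x k\<close> the distance term contributes another \<open>?n\<close>, whence the factor \<open>1 + (1 - \<nu>)\<close>.\<close>
    have "2 * ((1 - \<nu>) * ?n) \<le> (1 + (1 - \<nu>)) * ?n"
      using \<nu> by (simp add: algebra_simps)
    also have "\<dots> \<le> 2 * (\<alpha> k * ?r)"
      using iterate_inequality[OF assms, of k] by (simp add: algebra_simps)
    finally show ?thesis by simp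
  qed
  then have "(1 - \<nu>) / \<alpha> k * ?n \<le> ?r"
    using \<alpha>_pos[of k] by (simp add: field_simps)
  also have "\<dots> \<le> (\<sigma> k * (a k - u) + (b k - q))
      - (\<sigma> (Suc k) * (a (Suc k) - u) + (b (Suc k) - q))"
  proof -
    have "u \<le> a k" using lower_bounds(2)[of "x k"] assms by simp
    then have "\<sigma> (Suc k) * (a k - u) \<le> \<sigma> k * (a k - u)"
      using \<sigma>_Suc(2)[of k] by (simp add: mult_right_mono)
    then show ?thesis by (simp add: algebra_simps)
  qed
  finally show ?thesis .
qed

lemma edist_subdiff_sq_le:
  "(edist_set 0 (subdiff (wsum (\<sigma> (Suc k)) \<phi>1 \<phi>2) (x (Suc k))))\<^sup>2
    \<le> ereal (((1 + \<nu>) / \<alpha> k * norm (x (Suc k) - x k))\<^sup>2)"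
proof -
  interpret proximal_gradient_step "f k" "G k" "L k" "\<alpha> k" "x k" "x (Suc k)" by (rule step)
  let ?e = "edist_set 0 (subdiff (wsum (\<sigma> (Suc k)) \<phi>1 \<phi>2) (x (Suc k)))"
  have "L k = \<nu> / \<alpha> k" using \<alpha>_L[of k] \<alpha>_pos[of k] by (simp add: field_simps)
  then have "?e \<le> ereal ((1 + \<nu>) / \<alpha> k * norm (x (Suc k) - x k))"
    using edist_subdiff_le by (simp add: wsum_\<phi> add_divide_distrib)
  moreover have "0 \<le> ?e"
    unfolding edist_set_def by (intro INF_greatest) simp
  moreover from calculation have "0 \<le> ereal ((1 + \<nu>) / \<alpha> k * norm (x (Suc k) - x k))"
    by (meson order_trans)
  ultimately have "?e * ?e \<le> ereal ((1 + \<nu>) / \<alpha> k * norm (x (Suc k) - x k))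
      * ereal ((1 + \<nu>) / \<alpha> k * norm (x (Suc k) - x k))"
    by (intro ereal_mult_mono)
  then show ?thesis by (simp add: power2_eq_square)
qed

text \<open>
  Telescoping \<open>descent\<close> yields an index \<open>k\<close> with a small \<open>D k\<close>. The first bound follows from it by
  \<open>\<alpha> k \<le> \<nu> / L2\<close>. For the second, the subgradient bound contributes \<open>1 / (\<alpha> k)\<^sup>2\<close> and \<open>D k\<close> gives
  back one factor \<open>\<alpha> k\<close>; the remaining \<open>1 / \<alpha> k\<close> is at most \<open>L2 / \<nu> * (1 + \<sigma> 0 * L1 / L2)\<close>.
\<close>

lemma rates:
  assumes start: "\<phi>1 (x 0) = ereal (a 0)" "\<phi>2 (x 0) = ereal (b 0)" and L2: "0 < L2"
  defines "\<Phi> \<equiv> \<sigma> 0 * (a 0 - u) + (b 0 - q)" and "M \<equiv> 1 + \<nu> + \<nu> * \<sigma> 0 * L1 / L2"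
  obtains k where "k \<le> K"
    "(norm (x (Suc k) - x k))\<^sup>2 \<le> \<nu> * \<Phi> / ((1 - \<nu>) * L2 * (1 + real K))"
    "(edist_set 0 (subdiff (wsum (\<sigma> (Suc k)) \<phi>1 \<phi>2) (x (Suc k))))\<^sup>2
      \<le> ereal (L2 / \<nu> * (1 + \<sigma> 0 * L1 / L2) * (M\<^sup>2 * \<Phi> / ((1 - \<nu>) * (1 + real K))))"
proof -
  define D where "D k = (1 - \<nu>) / \<alpha> k * (norm (x (Suc k) - x k))\<^sup>2" for k
  define E where "E k = \<sigma> k * (a k - u) + (b k - q)" for k
  have finite_values: "\<phi>1 (x k) = ereal (a k)" "\<phi>2 (x k) = ereal (b k)" for k
    using start iterate_values by (cases k; simp)+
  have "D k \<le> E k - E (Suc k)" for k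
    unfolding D_def E_def by (rule descent[OF finite_values])
  moreover have "0 \<le> E k" for k
    using lower_bounds[of "x k"] \<sigma>_pos[of k] by (simp add: E_def finite_values)
  ultimately obtain k where k: "k \<le> K" and Dk: "D k \<le> E 0 / (1 + real K)"
    using telescoping_small_term[of D E K] by blast
  have E0: "E 0 = \<Phi>" by (simp add: E_def \<Phi>_def)
  have E0_nonneg: "0 \<le> \<Phi> / ((1 - \<nu>) * (1 + real K))"
    using \<open>0 \<le> E 0\<close> \<nu> by (simp add: E0)
  have n: "(norm (x (Suc k) - x k))\<^sup>2 \<le> \<alpha> k * (\<Phi> / ((1 - \<nu>) * (1 + real K)))"
  proof -
    have "(norm (x (Suc k) - x k))\<^sup>2 = \<alpha> k / (1 - \<nu>) * D k"
      using \<alpha>_pos[of k] \<nu> by (simp add: D_def)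
    also have "\<dots> \<le> \<alpha> k / (1 - \<nu>) * (\<Phi> / (1 + real K))"
      using Dk \<alpha>_pos[of k] \<nu> unfolding E0 by (intro mult_left_mono) auto
    finally show ?thesis by simp
  qed
  have "\<alpha> k \<le> \<nu> / L2"
    unfolding \<alpha>_def L_def using \<nu> L2 L_nonneg \<sigma>_pos[of "Suc k"] by (intro frac_le) auto
  then have "\<alpha> k * (\<Phi> / ((1 - \<nu>) * (1 + real K))) \<le> \<nu> / L2 * (\<Phi> / ((1 - \<nu>) * (1 + real K)))"
    using E0_nonneg by (rule mult_right_mono)
  with n have 1: "(norm (x (Suc k) - x k))\<^sup>2 \<le> \<nu> * \<Phi> / ((1 - \<nu>) * L2 * (1 + real K))"
    by (simp add: mult.commute mult.left_commute)
  have "((1 + \<nu>) / \<alpha> k * norm (x (Suc k) - x k))\<^sup>2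
      = ((1 + \<nu>) / \<alpha> k)\<^sup>2 * (norm (x (Suc k) - x k))\<^sup>2"
    by (rule power_mult_distrib)
  also have "\<dots> \<le> ((1 + \<nu>) / \<alpha> k)\<^sup>2 * (\<alpha> k * (\<Phi> / ((1 - \<nu>) * (1 + real K))))"
    by (intro mult_left_mono n) simp
  also have "\<dots> = 1 / \<alpha> k * ((1 + \<nu>)\<^sup>2 * (\<Phi> / ((1 - \<nu>) * (1 + real K))))"
    using \<alpha>_pos[of k] by (simp add: power2_eq_square)
  also have "\<dots> \<le> L2 / \<nu> * (1 + \<sigma> 0 * L1 / L2) * (M\<^sup>2 * (\<Phi> / ((1 - \<nu>) * (1 + real K))))"
  proof (intro mult_mono)
    show "1 / \<alpha> k \<le> L2 / \<nu> * (1 + \<sigma> 0 * L1 / L2)"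
    proof -
      have "1 / \<alpha> k \<le> (\<sigma> 0 * L1 + L2) / \<nu>"
        using L_le[of k] \<nu> by (simp add: \<alpha>_def divide_right_mono)
      also have "\<dots> = L2 / \<nu> * (1 + \<sigma> 0 * L1 / L2)"
        using L2 by (simp add: distrib_left add_divide_distrib)
      finally show ?thesis .
    qed
    show "(1 + \<nu>)\<^sup>2 \<le> M\<^sup>2"
      using \<nu> L2 L_nonneg \<sigma>_pos[of 0] by (intro power_mono) (auto simp: M_def)
    show "0 \<le> (1 + \<nu>)\<^sup>2 * (\<Phi> / ((1 - \<nu>) * (1 + real K)))"
      using E0_nonneg by (intro mult_nonneg_nonneg) auto
  qed (use \<nu> L2 L_nonneg \<sigma>_pos[of 0] E0_nonneg in auto)
  finally have 2: "(edist_set 0 (subdiff (wsum (\<sigma> (Suc k)) \<phi>1 \<phi>2) (x (Suc k))))\<^sup>2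
      \<le> ereal (L2 / \<nu> * (1 + \<sigma> 0 * L1 / L2) * (M\<^sup>2 * \<Phi> / ((1 - \<nu>) * (1 + real K))))"
    by (intro order_trans[OF edist_subdiff_sq_le]) simp
  from k 1 2 show ?thesis by (rule that)
qed

text \<open>
  If the starting point lies outside the domain of one of the objectives, the right-hand sides of
  the rates are infinite; otherwise the descent estimate is available from index zero.
\<close>

lemma shifted_objective_start:
  "shifted_objective (\<sigma> 0) \<phi>1 \<phi>2 (x 0) = \<infinity> \<or>
   \<phi>1 (x 0) = ereal (a 0) \<and> \<phi>2 (x 0) = ereal (b 0) \<and>
   shifted_objective (\<sigma> 0) \<phi>1 \<phi>2 (x 0) = ereal (\<sigma> 0 * (a 0 - u) + (b 0 - q))"
  using \<phi>_proper[of "x 0"] \<sigma>_pos[of 0] unfolding shifted_objective_def optimal_values a_def b_def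
  by (cases "\<phi>1 (x 0)"; cases "\<phi>2 (x 0)") auto

end

theorem theorem2p3:
  fixes f1 f2 :: "real ^ 'n \<Rightarrow> real" and g1 g2 :: "real ^ 'n \<Rightarrow> ereal"
    and L1 L2 \<nu> :: real and \<sigma> :: "nat \<Rightarrow> real" and x :: "nat \<Rightarrow> real ^ 'n"
  defines "\<phi>1 \<equiv> objective f1 g1" and "\<phi>2 \<equiv> objective f2 g2"
  defines "Mmax \<equiv> 1 + \<nu> + \<nu> * \<sigma> 0 * L1 / L2"
  assumes basic: "basic_assumption f1 f2 g1 g2"
    and lip1: "L1-lipschitz_on UNIV (grad f1)"
    and lip2: "L2-lipschitz_on UNIV (grad f2)"
    and steps_well_defined: "0 < L1 + L2"
    and alg: "staBiM f1 f2 g1 g2 L1 L2 \<nu> \<sigma> x"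
    and \<sigma>_lim: "decseq \<sigma>" "\<sigma> \<longlonglongrightarrow> 0"
    and \<sigma>_sum: "\<not> summable \<sigma>"
  shows "bounded (range x)
    \<and> (\<lambda>k. infdist (x k) (bilevel_solutions \<phi>1 \<phi>2)) \<longlonglongrightarrow> 0
    \<and> (L2 > 0 \<longrightarrow> (\<forall>K::nat.
         ereal (MIN k\<in>{..K}. (norm (x (Suc k) - x k))\<^sup>2)
           \<le> ereal \<nu> * shifted_objective (\<sigma> 0) \<phi>1 \<phi>2 (x 0)
               / ereal ((1 - \<nu>) * L2 * (1 + real K))
       \<and> (MIN k\<in>{..K}. (edist_set 0 (subdiff (wsum (\<sigma> (Suc k)) \<phi>1 \<phi>2) (x (Suc k))))\<^sup>2)
           \<le> ereal (L2 / \<nu> * (1 + \<sigma> 0 * L1 / L2))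
               * (ereal (Mmax\<^sup>2) * shifted_objective (\<sigma> 0) \<phi>1 \<phi>2 (x 0)
                   / ereal ((1 - \<nu>) * (1 + real K)))))"
proof -
  interpret S: stabim_iteration f1 f2 g1 g2 L1 L2 \<nu> \<sigma> x
    by (rule stabim_iteration.intro) fact+
  note \<phi> = \<phi>1_def[folded S.\<phi>1_def] \<phi>2_def[folded S.\<phi>2_def]
  let ?X = "bilevel_solutions \<phi>1 \<phi>2" and ?\<Phi> = "shifted_objective (\<sigma> 0) \<phi>1 \<phi>2 (x 0)"
  have X: "?X = S.solutions" by (simp add: S.solutions_def \<phi>)
  have conv: "(\<lambda>k. infdist (x k) ?X) \<longlonglongrightarrow> 0"
    unfolding X using \<sigma>_lim(2) \<sigma>_sum by (rule S.infdist_tendsto_0)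
  then obtain e where "\<And>k. infdist (x k) ?X \<le> e"
    using convergent_imp_Bseq[OF convergentI] Bseq_def by (metis abs_le_D1 real_norm_def)
  then have "bounded (range x)"
    using S.solutions by (intro bounded_infdist_le[where S = ?X]) (auto simp: X)
  moreover have "ereal (MIN k\<in>{..K}. (norm (x (Suc k) - x k))\<^sup>2)
        \<le> ereal \<nu> * ?\<Phi> / ereal ((1 - \<nu>) * L2 * (1 + real K))
      \<and> (MIN k\<in>{..K}. (edist_set 0 (subdiff (wsum (\<sigma> (Suc k)) \<phi>1 \<phi>2) (x (Suc k))))\<^sup>2)
        \<le> ereal (L2 / \<nu> * (1 + \<sigma> 0 * L1 / L2))
            * (ereal (Mmax\<^sup>2) * ?\<Phi> / ereal ((1 - \<nu>) * (1 + real K)))"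
    if L2: "0 < L2" for K
  proof (cases "?\<Phi> = \<infinity>")
    case True
    \<comment> \<open>An infinite shifted objective at the starting point makes both right-hand sides infinite.\<close>
    have inf1: "ereal c * \<infinity> / ereal d = \<infinity>"
      and inf2: "ereal c * (ereal m * \<infinity> / ereal d) = \<infinity>"
      if "0 < c" "0 < m" "0 < d" for c m d :: real
      using that by simp_all
    have C: "0 < L2 / \<nu> * (1 + \<sigma> 0 * L1 / L2)"
      using S.\<nu> L2 S.L_nonneg S.\<sigma>_pos[of 0] by (intro mult_pos_pos add_pos_nonneg) auto
    have "0 < Mmax"
      using S.\<nu> L2 S.L_nonneg S.\<sigma>_pos[of 0] unfolding Mmax_def by (intro add_pos_nonneg) auto
    then have M: "0 < Mmax\<^sup>2" by simp
    have d: "0 < (1 - \<nu>) * L2 * (1 + real K)" "0 < (1 - \<nu>) * (1 + real K)"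
      using S.\<nu> L2 by auto
    show ?thesis
      unfolding True inf1[OF S.\<nu>(1) zero_less_one d(1)] inf2[OF C M d(2)] by simp
  next
    case False
    then have start: "S.\<phi>1 (x 0) = ereal (S.a 0)" "S.\<phi>2 (x 0) = ereal (S.b 0)"
      and \<Phi>: "?\<Phi> = ereal (\<sigma> 0 * (S.a 0 - S.u) + (S.b 0 - S.q))"
      using S.shifted_objective_start by (auto simp: \<phi>)
    obtain k where k: "k \<le> K"
      and rate1: "(norm (x (Suc k) - x k))\<^sup>2
        \<le> \<nu> * (\<sigma> 0 * (S.a 0 - S.u) + (S.b 0 - S.q)) / ((1 - \<nu>) * L2 * (1 + real K))"
      and rate2: "(edist_set 0 (subdiff (wsum (\<sigma> (Suc k)) S.\<phi>1 S.\<phi>2) (x (Suc k))))\<^sup>2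
        \<le> ereal (L2 / \<nu> * (1 + \<sigma> 0 * L1 / L2) * (Mmax\<^sup>2 *
            (\<sigma> 0 * (S.a 0 - S.u) + (S.b 0 - S.q)) / ((1 - \<nu>) * (1 + real K))))"
      using S.rates[OF start L2, of K] unfolding Mmax_def by blast
    have "(MIN k\<in>{..K}. (norm (x (Suc k) - x k))\<^sup>2) \<le> (norm (x (Suc k) - x k))\<^sup>2"
      using k by (intro Min_le) auto
    moreover have "(MIN k\<in>{..K}. (edist_set 0 (subdiff (wsum (\<sigma> (Suc k)) \<phi>1 \<phi>2) (x (Suc k))))\<^sup>2)
        \<le> (edist_set 0 (subdiff (wsum (\<sigma> (Suc k)) \<phi>1 \<phi>2) (x (Suc k))))\<^sup>2"
      using k by (intro Min_le) auto
    moreover have "(1 - \<nu>) * L2 * (1 + real K) \<noteq> 0" "(1 - \<nu>) * (1 + real K) \<noteq> 0"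
      using S.\<nu> L2 by auto
    ultimately show ?thesis
      using order_trans[OF _ rate1] order_trans[OF _ rate2] unfolding \<Phi>
      by (simp add: \<phi>)
  qed
  ultimately show ?thesis using conv by blast
qed

end
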